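(* Let $(\Omega,\mathcal{A},\mu)$ be a $\sigma$-finite measure space satisfying the following two conditions: (i) there is a countable family $\mathcal{A}_1\subset\mathcal{A}$ such that, for every $M\in\mathcal{A}$ with $\mu(M)<\infty$ and every $\varepsilon>0$, there exists $M_0\in\mathcal{A}_1$ with $\mu(M\,\Delta\,M_0)<\varepsilon$; (ii) there is a countable family $\{A_n:n\in\mathbb{N}\}\subset\mathcal{A}$ of mutually disjoint measurable sets such that $\mu(A_n)>0$ for all $n\in\mathbb{N}$ and $\lim_{n\to\infty}\mu(A_n)=0$. Then $(\mathcal{S}_c\cap\mathcal{S}_{au})\setminus\mathcal{S}_u$ is $\mathfrak{c}$-dense-lineable in $L_0^{\mathbb{N}}$. In particular, $\mathcal{S}_c\setminus\mathcal{S}_u$ and $\mathcal{S}_{au}\setminus\mathcal{S}_u$ are $\mathfrak{c}$-dense-lineable in $L_0^{\mathbb{N}}$.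
   Context: $(\Omega,\mathcal{A},\mu)$ is a positive measure space; $A\,\Delta\,B=(A\setminus B)\cup(B\setminus A)$. It is $\sigma$-finite if $\Omega$ is a countable union of measurable sets of finite measure. $L_0$ is the real vector space of ($\mu$-a.e. equality classes of) measurable functions $f:\Omega\to\mathbb{R}$, with the topology of local convergence in measure, i.e. the vector topology with a base of $0$-neighborhoods given by the sets $\{f\in L_0:\int_K\min\{1,|f|\}\,d\mu<\varepsilon\}$, $\varepsilon>0$, $K\in\mathcal{A}$, $\mu(K)<\infty$. $L_0^{\mathbb{N}}$ is the vector space of all sequences $(f_n)_{n\in\mathbb{N}}$ in $L_0$, with the product topology. Subsets of $L_0^{\mathbb{N}}$: $\mathcal{S}_u$: sequences with $f_n\to0$ uniformly almost everywhere (there is $Z\in\mathcal{A}$ with $\mu(Z)=0$ and $f_n\to0$ uniformly on $\Omega\setminus Z$). $\mathcal{S}_{au}$: $f_n\to0$ almost uniformly (for every $\varepsilon>0$ there is $Z_\varepsilon\in\mathcal{A}$ with $\mu(Z_\varepsilon)<\varepsilon$ and $f_n\to0$ uniformly on $\Omega\setminus Z_\varepsilon$). $\mathcal{S}_c$: $f_n\to0$ completely ($\sum_{n=1}^\infty\mu(\{|f_n|>\varepsilon\})<\infty$ for every $\varepsilon>0$). $\mathfrak{c}$ is the cardinality of the continuum. A subset $A$ of a topological vector space $X$ is $\mathfrak{c}$-dense-lineable in $X$ if there is a dense vector subspace $V\subset X$ with $\dim(V)=\mathfrak{c}$ and $V\setminus\{0\}\subset A$. *)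

theory Defs
  imports
    "HOL-Analysis.Analysis"
    "Jordan_Normal_Form.VS_Connect"
begin

section \<open>The vector space of classes of measurable functions\<close>

definition ae_rel :: "'a measure \<Rightarrow> (('a \<Rightarrow> real) \<times> ('a \<Rightarrow> real)) set" where
  "ae_rel M = {(f, g). f \<in> borel_measurable M \<and> g \<in> borel_measurable M \<and> (AE x in M. f x = g x)}"

definition ae_class :: "'a measure \<Rightarrow> ('a \<Rightarrow> real) \<Rightarrow> ('a \<Rightarrow> real) set" where
  "ae_class M f = ae_rel M `` {f}"

text \<open>The fields \<open>mult\<close> and \<open>one\<close> are inherited from the record of rings and play no role
  in a module.\<close>

definition L0 :: "'a measure \<Rightarrow> (real, ('a \<Rightarrow> real) set) module" where
  "L0 M = \<lparr>carrier = borel_measurable M // ae_rel M,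
           mult = undefined, one = undefined,
           zero = ae_class M (\<lambda>x. 0),
           add = (\<lambda>F G. \<Union>f\<in>F. \<Union>g\<in>G. ae_class M (\<lambda>x. f x + g x)),
           smult = (\<lambda>c F. \<Union>f\<in>F. ae_class M (\<lambda>x. c * f x))\<rparr>"

definition L0_seq :: "'a measure \<Rightarrow> (real, nat \<Rightarrow> ('a \<Rightarrow> real) set) module" where
  "L0_seq M = \<lparr>carrier = {s. \<forall>n. s n \<in> carrier (L0 M)},
               mult = undefined, one = undefined,
               zero = (\<lambda>n. \<zero>\<^bsub>L0 M\<^esub>),
               add = (\<lambda>s t n. s n \<oplus>\<^bsub>L0 M\<^esub> t n),
               smult = (\<lambda>c s n. c \<odot>\<^bsub>L0 M\<^esub> s n)\<rparr>"

lemma equiv_ae_rel: "equiv (borel_measurable M) (ae_rel M)"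
proof (rule equivI)
  show "ae_rel M \<subseteq> borel_measurable M \<times> borel_measurable M"
    by (auto simp: ae_rel_def)
  show "refl_on (borel_measurable M) (ae_rel M)"
    by (auto simp: refl_on_def ae_rel_def)
  show "sym (ae_rel M)"
    by (auto simp: sym_def ae_rel_def elim: eventually_mono)
  show "trans (ae_rel M)"
    by (auto simp: trans_def ae_rel_def elim: eventually_elim2)
qed

lemma ae_class_eq_iff:
  assumes "f \<in> borel_measurable M" "g \<in> borel_measurable M"
  shows "ae_class M f = ae_class M g \<longleftrightarrow> (AE x in M. f x = g x)"
  using eq_equiv_class_iff[OF equiv_ae_rel assms] assms by (auto simp: ae_class_def ae_rel_def)

lemma mem_ae_class_iff:
  "g \<in> ae_class M f \<longleftrightarrow> f \<in> borel_measurable M \<and> g \<in> borel_measurable M \<and> (AE x in M. f x = g x)"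
  by (auto simp: ae_class_def ae_rel_def)

lemma carrier_L0: "carrier (L0 M) = ae_class M ` borel_measurable M"
  by (auto simp: L0_def quotient_def ae_class_def)

lemma L0_add:
  assumes "f \<in> borel_measurable M" "g \<in> borel_measurable M"
  shows "ae_class M f \<oplus>\<^bsub>L0 M\<^esub> ae_class M g = ae_class M (\<lambda>x. f x + g x)"
proof -
  have *: "ae_class M (\<lambda>x. f' x + g' x) = ae_class M (\<lambda>x. f x + g x)"
    if "f' \<in> ae_class M f" "g' \<in> ae_class M g" for f' g'
    using that by (subst ae_class_eq_iff) (auto simp: mem_ae_class_iff elim: eventually_elim2)
  have "f \<in> ae_class M f" "g \<in> ae_class M g"
    using assms by (auto simp: mem_ae_class_iff)
  then have "ae_class M f \<noteq> {}" "ae_class M g \<noteq> {}"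
    by auto
  then show ?thesis
    by (simp add: L0_def * cong: SUP_cong_simp)
qed

lemma L0_smult:
  assumes "f \<in> borel_measurable M"
  shows "c \<odot>\<^bsub>L0 M\<^esub> ae_class M f = ae_class M (\<lambda>x. c * f x)"
proof -
  have *: "ae_class M (\<lambda>x. c * f' x) = ae_class M (\<lambda>x. c * f x)" if "f' \<in> ae_class M f" for f'
  proof (subst ae_class_eq_iff)
    have "AE x in M. f x = f' x"
      using that by (simp add: mem_ae_class_iff)
    then show "AE x in M. c * f' x = c * f x"
      by (rule eventually_mono) simp
  qed (use that in \<open>auto simp: mem_ae_class_iff\<close>)
  have "f \<in> ae_class M f"
    using assms by (auto simp: mem_ae_class_iff)
  then have "ae_class M f \<noteq> {}"
    by auto
  then show ?thesis
    by (simp add: L0_def * cong: SUP_cong_simp)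
qed

lemma L0_zero: "\<zero>\<^bsub>L0 M\<^esub> = ae_class M (\<lambda>x. 0)"
  by (simp add: L0_def)

lemma module_L0: "module class_ring (L0 M)"
proof (rule moduleI)
  show "cring (class_ring :: real ring)"
    by (rule class_cring.cring_axioms)
  show "abelian_group (L0 M)"
  proof (rule abelian_groupI)
    fix F assume "F \<in> carrier (L0 M)"
    then obtain f where f: "f \<in> borel_measurable M" "F = ae_class M f"
      by (auto simp: carrier_L0)
    show "\<exists>G\<in>carrier (L0 M). G \<oplus>\<^bsub>L0 M\<^esub> F = \<zero>\<^bsub>L0 M\<^esub>"
      by (rule bexI[of _ "ae_class M (\<lambda>x. - f x)"]) (use f in \<open>auto simp: carrier_L0 L0_add L0_zero\<close>)
  qed (auto simp: carrier_L0 L0_add L0_zero add_ac)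
qed (auto simp: carrier_L0 L0_add L0_smult algebra_simps)

lemma vectorspace_L0_seq: "vectorspace class_ring (L0_seq M)"
proof -
  interpret module class_ring "L0 M" by (rule module_L0)
  have "module class_ring (L0_seq M)"
  proof (rule moduleI)
    show "cring (class_ring :: real ring)"
      by (rule class_cring.cring_axioms)
    show "abelian_group (L0_seq M)"
    proof (rule abelian_groupI)
      fix s assume "s \<in> carrier (L0_seq M)"
      then show "\<exists>t\<in>carrier (L0_seq M). t \<oplus>\<^bsub>L0_seq M\<^esub> s = \<zero>\<^bsub>L0_seq M\<^esub>"
        by (intro bexI[of _ "\<lambda>n. \<ominus>\<^bsub>L0 M\<^esub> s n"]) (auto simp: L0_seq_def M.l_neg)
    qed (auto simp: L0_seq_def M.a_ac fun_eq_iff)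
  next
    fix a b :: real and s t assume "s \<in> carrier (L0_seq M)" "t \<in> carrier (L0_seq M)"
    then show "(a \<oplus>\<^bsub>class_ring\<^esub> b) \<odot>\<^bsub>L0_seq M\<^esub> s =
        (a \<odot>\<^bsub>L0_seq M\<^esub> s) \<oplus>\<^bsub>L0_seq M\<^esub> (b \<odot>\<^bsub>L0_seq M\<^esub> s)"
      "a \<odot>\<^bsub>L0_seq M\<^esub> (s \<oplus>\<^bsub>L0_seq M\<^esub> t) =
        (a \<odot>\<^bsub>L0_seq M\<^esub> s) \<oplus>\<^bsub>L0_seq M\<^esub> (a \<odot>\<^bsub>L0_seq M\<^esub> t)"
      "(a \<otimes>\<^bsub>class_ring\<^esub> b) \<odot>\<^bsub>L0_seq M\<^esub> s = a \<odot>\<^bsub>L0_seq M\<^esub> (b \<odot>\<^bsub>L0_seq M\<^esub> s)"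
      using smult_l_distr smult_r_distr smult_assoc1 by (auto simp: L0_seq_def fun_eq_iff)
  qed (use smult_closed smult_one in \<open>auto simp: L0_seq_def\<close>)
  then show ?thesis
    by (simp add: vectorspace_def class_field.field_axioms)
qed


section \<open>The topology of local convergence in measure\<close>

definition L0_nhd :: "'a measure \<Rightarrow> 'a set \<Rightarrow> real \<Rightarrow> ('a \<Rightarrow> real) set set" where
  "L0_nhd M K \<epsilon> = ae_class M ` {f \<in> borel_measurable M. (LINT x:K|M. min 1 \<bar>f x\<bar>) < \<epsilon>}"

definition L0_open :: "'a measure \<Rightarrow> ('a \<Rightarrow> real) set set \<Rightarrow> bool" where
  "L0_open M U \<longleftrightarrow> U \<subseteq> carrier (L0 M) \<and>
     (\<forall>F\<in>U. \<exists>K \<epsilon>. K \<in> sets M \<and> emeasure M K < \<infinity> \<and> \<epsilon> > 0 \<and> (\<lambda>G. F \<oplus>\<^bsub>L0 M\<^esub> G) ` L0_nhd M K \<epsilon> \<subseteq> U)"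

definition L0_topology :: "'a measure \<Rightarrow> ('a \<Rightarrow> real) set topology" where
  "L0_topology M = topology (L0_open M)"

definition L0_seq_topology :: "'a measure \<Rightarrow> (nat \<Rightarrow> ('a \<Rightarrow> real) set) topology" where
  "L0_seq_topology M = product_topology (\<lambda>_. L0_topology M) UNIV"

lemma L0_nhd_mono:
  assumes "K \<in> sets M" "L \<in> sets M" "emeasure M L < \<infinity>" "K \<subseteq> L" "\<delta> \<le> \<epsilon>"
  shows "L0_nhd M L \<delta> \<subseteq> L0_nhd M K \<epsilon>"
proof -
  have "(LINT x:K|M. min 1 \<bar>f x\<bar>) \<le> (LINT x:L|M. min 1 \<bar>f x\<bar>)"
    if f [measurable]: "f \<in> borel_measurable M" for f :: "'a \<Rightarrow> real"
  proof -
    have *: "set_integrable M A (\<lambda>x. min 1 \<bar>f x\<bar>)" if "A \<in> sets M" "emeasure M A < \<infinity>" for A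
      unfolding set_integrable_def
      by (rule integrableI_bounded_set_indicator[where B=1]) (use that in auto)
    moreover have "emeasure M K < \<infinity>"
      using assms by (meson emeasure_mono le_less_trans)
    ultimately show ?thesis
      using assms unfolding set_lebesgue_integral_def set_integrable_def
      by (intro integral_mono) (auto simp: indicator_def)
  qed
  with assms(5) show ?thesis
    by (force simp: L0_nhd_def)
qed

lemma istopology_L0_open: "istopology (L0_open M)"
  unfolding istopology_def
proof (intro conjI allI impI)
  fix S T assume S: "L0_open M S" and T: "L0_open M T"
  show "L0_open M (S \<inter> T)"
    unfolding L0_open_def
  proof (intro conjI ballI)
    show "S \<inter> T \<subseteq> carrier (L0 M)"
      using S by (auto simp: L0_open_def)
    fix F assume "F \<in> S \<inter> T"
    then obtain K \<epsilon> L \<delta> where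
        K: "K \<in> sets M" "emeasure M K < \<infinity>" "\<epsilon> > 0" "(\<lambda>G. F \<oplus>\<^bsub>L0 M\<^esub> G) ` L0_nhd M K \<epsilon> \<subseteq> S" and
        L: "L \<in> sets M" "emeasure M L < \<infinity>" "\<delta> > 0" "(\<lambda>G. F \<oplus>\<^bsub>L0 M\<^esub> G) ` L0_nhd M L \<delta> \<subseteq> T"
      using S T by (force simp: L0_open_def)
    have "emeasure M (K \<union> L) \<le> emeasure M K + emeasure M L"
      using K L by (intro emeasure_subadditive)
    also have "\<dots> < \<infinity>"
      using K L by simp
    finally have fin: "emeasure M (K \<union> L) < \<infinity>" .
    have "L0_nhd M (K \<union> L) (min \<epsilon> \<delta>) \<subseteq> L0_nhd M K \<epsilon> \<inter> L0_nhd M L \<delta>"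
      using K L fin by (intro Int_greatest L0_nhd_mono) auto
    then have "(\<lambda>G. F \<oplus>\<^bsub>L0 M\<^esub> G) ` L0_nhd M (K \<union> L) (min \<epsilon> \<delta>) \<subseteq> S \<inter> T"
      using K(4) L(4) by blast
    with K(1,3) L(1,3) fin show "\<exists>K \<epsilon>. K \<in> sets M \<and> emeasure M K < \<infinity> \<and> \<epsilon> > 0 \<and>
        (\<lambda>G. F \<oplus>\<^bsub>L0 M\<^esub> G) ` L0_nhd M K \<epsilon> \<subseteq> S \<inter> T"
      by (intro exI[of _ "K \<union> L"] exI[of _ "min \<epsilon> \<delta>"]) auto
  qed
next
  fix \<U> assume \<U>: "\<forall>U\<in>\<U>. L0_open M U"
  show "L0_open M (\<Union>\<U>)"
    unfolding L0_open_def
  proof (intro conjI ballI)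
    show "\<Union>\<U> \<subseteq> carrier (L0 M)"
      using \<U> by (auto simp: L0_open_def)
    fix F assume "F \<in> \<Union>\<U>"
    then obtain U where "U \<in> \<U>" "F \<in> U" by blast
    with \<U> obtain K \<epsilon> where "K \<in> sets M" "emeasure M K < \<infinity>" "\<epsilon> > 0"
        "(\<lambda>G. F \<oplus>\<^bsub>L0 M\<^esub> G) ` L0_nhd M K \<epsilon> \<subseteq> U"
      unfolding L0_open_def by meson
    with \<open>U \<in> \<U>\<close> show "\<exists>K \<epsilon>. K \<in> sets M \<and> emeasure M K < \<infinity> \<and> \<epsilon> > 0 \<and>
        (\<lambda>G. F \<oplus>\<^bsub>L0 M\<^esub> G) ` L0_nhd M K \<epsilon> \<subseteq> \<Union>\<U>"
      by blast
  qed
qed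

lemma openin_L0_topology: "openin (L0_topology M) = L0_open M"
  by (simp add: L0_topology_def istopology_L0_open)

lemma topspace_L0_topology: "topspace (L0_topology M) = carrier (L0 M)"
proof -
  have "L0_open M (carrier (L0 M))"
    unfolding L0_open_def
    by (auto intro!: exI[of _ "{}"] exI[of _ "1::real"] simp: L0_nhd_def carrier_L0 L0_add)
  then show ?thesis
    by (auto simp: topspace_def openin_L0_topology L0_open_def)
qed

lemma topspace_L0_seq_topology: "topspace (L0_seq_topology M) = carrier (L0_seq M)"
  by (auto simp: L0_seq_topology_def topspace_L0_topology L0_seq_def PiE_UNIV_domain)


section \<open>Modes of convergence to zero\<close>

text \<open>A sequence of classes belongs to one of the sets below if some sequence of
  representatives converges in the respective mode; the lemmas at the end of this section show
  that the choice of representatives is immaterial.\<close>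

definition S_u :: "'a measure \<Rightarrow> (nat \<Rightarrow> ('a \<Rightarrow> real) set) set" where
  "S_u M = {\<lambda>n. ae_class M (f n) | f. (\<forall>n. f n \<in> borel_measurable M) \<and>
     (\<exists>Z\<in>null_sets M. uniform_limit (space M - Z) f (\<lambda>x. 0) sequentially)}"

definition S_au :: "'a measure \<Rightarrow> (nat \<Rightarrow> ('a \<Rightarrow> real) set) set" where
  "S_au M = {\<lambda>n. ae_class M (f n) | f. (\<forall>n. f n \<in> borel_measurable M) \<and>
     (\<forall>\<epsilon>>0. \<exists>Z\<in>sets M. emeasure M Z < ennreal \<epsilon> \<and>
        uniform_limit (space M - Z) f (\<lambda>x. 0) sequentially)}"

definition S_c :: "'a measure \<Rightarrow> (nat \<Rightarrow> ('a \<Rightarrow> real) set) set" where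
  "S_c M = {\<lambda>n. ae_class M (f n) | f. (\<forall>n. f n \<in> borel_measurable M) \<and>
     (\<forall>\<epsilon>>0. (\<Sum>n. emeasure M {x \<in> space M. \<bar>f n x\<bar> > \<epsilon>}) < \<infinity>)}"

lemma ae_class_seq_eqE:
  fixes f g :: "nat \<Rightarrow> 'a \<Rightarrow> real"
  assumes "(\<lambda>n. ae_class M (f n)) = (\<lambda>n. ae_class M (g n))"
    and "\<And>n. f n \<in> borel_measurable M" "\<And>n. g n \<in> borel_measurable M"
  obtains N where "N \<in> null_sets M" "\<And>n x. x \<in> space M - N \<Longrightarrow> f n x = g n x"
proof -
  have "AE x in M. f n x = g n x" for n
    using fun_cong[OF assms(1), of n] assms(2,3) by (simp add: ae_class_eq_iff)
  then have "AE x in M. \<forall>n. f n x = g n x"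
    by (simp add: AE_all_countable)
  then obtain N where "N \<in> null_sets M" "{x \<in> space M. \<not> (\<forall>n. f n x = g n x)} \<subseteq> N"
    by (auto simp: eventually_ae_filter)
  then show ?thesis
    by (intro that[of N]) auto
qed

lemma uniform_limit_off_null_set:
  assumes "\<And>n x. x \<in> space M - N \<Longrightarrow> g n x = f n x"
    and "uniform_limit (space M - Z) g (\<lambda>x. 0) sequentially"
  shows "uniform_limit (space M - (Z \<union> N)) f (\<lambda>x. 0 :: real) sequentially"
proof -
  have "uniform_limit (space M - (Z \<union> N)) g (\<lambda>x. 0) sequentially"
    by (rule uniform_limit_on_subset[OF assms(2)]) auto
  then show ?thesis
    by (rule uniform_limit_cong'[THEN iffD1, rotated -1]) (use assms(1) in auto)
qed

lemma S_u_iff: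
  assumes "\<And>n. f n \<in> borel_measurable M"
  shows "(\<lambda>n. ae_class M (f n)) \<in> S_u M \<longleftrightarrow>
    (\<exists>Z\<in>null_sets M. uniform_limit (space M - Z) f (\<lambda>x. 0) sequentially)" (is "_ \<longleftrightarrow> ?P")
proof
  assume "(\<lambda>n. ae_class M (f n)) \<in> S_u M"
  then obtain g Z where g: "(\<lambda>n. ae_class M (g n)) = (\<lambda>n. ae_class M (f n))"
      "\<And>n. g n \<in> borel_measurable M" and
      Z: "Z \<in> null_sets M" "uniform_limit (space M - Z) g (\<lambda>x. 0) sequentially"
    by (force simp: S_u_def)
  obtain N where N: "N \<in> null_sets M" "\<And>n x. x \<in> space M - N \<Longrightarrow> g n x = f n x"
    using ae_class_seq_eqE[OF g assms] by blast
  have "Z \<union> N \<in> null_sets M"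
    using Z N by auto
  with uniform_limit_off_null_set[OF N(2) Z(2)] show ?P by blast
qed (use assms in \<open>auto simp: S_u_def\<close>)

lemma S_au_iff:
  assumes "\<And>n. f n \<in> borel_measurable M"
  shows "(\<lambda>n. ae_class M (f n)) \<in> S_au M \<longleftrightarrow>
    (\<forall>\<epsilon>>0. \<exists>Z\<in>sets M. emeasure M Z < ennreal \<epsilon> \<and>
       uniform_limit (space M - Z) f (\<lambda>x. 0) sequentially)" (is "_ \<longleftrightarrow> ?P")
proof
  assume "(\<lambda>n. ae_class M (f n)) \<in> S_au M"
  then obtain g where g: "(\<lambda>n. ae_class M (g n)) = (\<lambda>n. ae_class M (f n))"
      "\<And>n. g n \<in> borel_measurable M" and
      Z: "\<forall>\<epsilon>>0. \<exists>Z\<in>sets M. emeasure M Z < ennreal \<epsilon> \<and>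
        uniform_limit (space M - Z) g (\<lambda>x. 0) sequentially"
    by (force simp: S_au_def)
  obtain N where N: "N \<in> null_sets M" "\<And>n x. x \<in> space M - N \<Longrightarrow> g n x = f n x"
    using ae_class_seq_eqE[OF g assms] by blast
  show ?P
  proof (intro allI impI)
    fix \<epsilon> :: real assume "\<epsilon> > 0"
    with Z obtain Z where Z: "Z \<in> sets M" "emeasure M Z < ennreal \<epsilon>"
        "uniform_limit (space M - Z) g (\<lambda>x. 0) sequentially"
      by blast
    then show "\<exists>Z\<in>sets M. emeasure M Z < ennreal \<epsilon> \<and>
        uniform_limit (space M - Z) f (\<lambda>x. 0) sequentially"
      using N uniform_limit_off_null_set[OF N(2) Z(3)]
      by (intro bexI[of _ "Z \<union> N"]) (auto simp: emeasure_Un_null_set)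
  qed
qed (use assms in \<open>auto simp: S_au_def\<close>)

lemma S_c_iff:
  assumes "\<And>n. f n \<in> borel_measurable M"
  shows "(\<lambda>n. ae_class M (f n)) \<in> S_c M \<longleftrightarrow>
    (\<forall>\<epsilon>>0. (\<Sum>n. emeasure M {x \<in> space M. \<bar>f n x\<bar> > \<epsilon>}) < \<infinity>)" (is "_ \<longleftrightarrow> ?P")
proof
  assume "(\<lambda>n. ae_class M (f n)) \<in> S_c M"
  then obtain g where g: "(\<lambda>n. ae_class M (g n)) = (\<lambda>n. ae_class M (f n))"
      "\<And>n. g n \<in> borel_measurable M" and
      c: "\<forall>\<epsilon>>0. (\<Sum>n. emeasure M {x \<in> space M. \<bar>g n x\<bar> > \<epsilon>}) < \<infinity>"
    by (force simp: S_c_def)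
  note [measurable] = assms g(2)
  have "emeasure M {x \<in> space M. \<bar>g n x\<bar> > \<epsilon>} = emeasure M {x \<in> space M. \<bar>f n x\<bar> > \<epsilon>}" for n \<epsilon>
  proof (rule emeasure_eq_AE)
    have "AE x in M. g n x = f n x"
      using fun_cong[OF g(1), of n] g(2) assms by (simp add: ae_class_eq_iff)
    then show "AE x in M. x \<in> {x \<in> space M. \<bar>g n x\<bar> > \<epsilon>} \<longleftrightarrow> x \<in> {x \<in> space M. \<bar>f n x\<bar> > \<epsilon>}"
      by (auto elim: eventually_mono)
  qed auto
  with c show ?P by simp
qed (use assms in \<open>auto simp: S_c_def\<close>)


section \<open>Lineability\<close>

text \<open>The topological vector space is given by a real vector space \<open>X\<close> and a topology \<open>T\<close> on
  its carrier. The dimension of \<open>V\<close> is the cardinality of a Hamel basis \<open>B\<close> of \<open>V\<close>.\<close>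

definition continuum_dense_lineable ::
    "(real, 'v, 'm) module_scheme \<Rightarrow> 'v topology \<Rightarrow> 'v set \<Rightarrow> bool" where
  "continuum_dense_lineable X T A \<longleftrightarrow>
     (\<exists>V B. VectorSpace.subspace class_ring V X \<and>
        T closure_of V = topspace T \<and>
        vectorspace.basis class_ring (X\<lparr>carrier := V\<rparr>) B \<and> eqpoll B (UNIV :: real set) \<and>
        V - {\<zero>\<^bsub>X\<^esub>} \<subseteq> A)"

end

theory Submission
  imports Defs
begin

text \<open>Passing to a subsequence (possibly with repetitions) we may assume \<open>\<mu>(A\<^sub>n) \<le> (1/2)\<^sup>n\<close>.
  For a real \<open>t\<close> consider the sequence of functions \<open>exp(n exp t) 1\<^bsub>A n\<^esub>\<close>.
  A nontrivial linear combination of these sequences lives on the sets \<open>A\<^sub>n\<close>, so it converges to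
  zero completely and almost uniformly; on \<open>A\<^sub>n\<close> it is a constant in which the term of the largest
  \<open>t\<close> dominates, so it does not converge uniformly almost everywhere. None of this is affected by
  changing finitely many terms to functions with supports of finite measure. A countable set of
  such functions is dense in \<open>L\<^sub>0\<close>, and its finite lists are countably many: for each list
  one \<open>t \<in> \<nat>\<close> is reserved, and the list replaces the first terms of the sequence of \<open>t\<close>. The modified
  sequences are dense in the product topology and form a basis, indexed by the reals, of their span.\<close>

section \<open>Truncated distances on sets of finite measure\<close>

text \<open>For a fixed \<open>K\<close> of finite measure this is a pseudometric whose balls around
  0 give the sets \<open>L0_nhd M K \<epsilon>\<close>. It is stated for functions rather than
  classes, so that the approximation below avoids the quotient.\<close>

definition meas_dist :: "'a measure \<Rightarrow> 'a set \<Rightarrow> ('a \<Rightarrow> real) \<Rightarrow> ('a \<Rightarrow> real) \<Rightarrow> real" where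
  "meas_dist M K f g = (LINT x:K|M. min 1 \<bar>f x - g x\<bar>)"

lemma set_integrable_bounded:
  fixes h :: "'a \<Rightarrow> real"
  assumes "K \<in> sets M" "emeasure M K < \<infinity>" "h \<in> borel_measurable M" "\<And>x. \<bar>h x\<bar> \<le> C"
  shows "set_integrable M K h"
  unfolding set_integrable_def
  by (rule integrableI_bounded_set_indicator[where B = C]) (use assms in auto)

text \<open>The truncation \<open>min 1\<close> is monotone and subadditive on nonnegative reals, so
  a pointwise bound integrates over \<open>K\<close>. This form covers both the triangle inequality
  and the estimate for a sum of two approximations.\<close>

lemma meas_dist_le_add:
  assumes K: "K \<in> sets M" "emeasure M K < \<infinity>"
    and [measurable]: "f \<in> borel_measurable M" "g \<in> borel_measurable M" "f' \<in> borel_measurable M"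
      "g' \<in> borel_measurable M" "f'' \<in> borel_measurable M" "g'' \<in> borel_measurable M"
    and le: "\<And>x. x \<in> space M \<Longrightarrow> \<bar>f x - g x\<bar> \<le> \<bar>f' x - g' x\<bar> + \<bar>f'' x - g'' x\<bar>"
  shows "meas_dist M K f g \<le> meas_dist M K f' g' + meas_dist M K f'' g''"
proof -
  have int: "set_integrable M K (\<lambda>x. min 1 \<bar>u x - v x\<bar>)"
    if "u \<in> borel_measurable M" "v \<in> borel_measurable M" for u v :: "'a \<Rightarrow> real"
    by (rule set_integrable_bounded[where C = 1]) (use K that in auto)
  have "meas_dist M K f g \<le> (LINT x:K|M. min 1 \<bar>f' x - g' x\<bar> + min 1 \<bar>f'' x - g'' x\<bar>)"
    unfolding meas_dist_def
  proof (rule set_integral_mono)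
    fix x assume "x \<in> K"
    then have "x \<in> space M" using K sets.sets_into_space by blast
    from le[OF this] show "min 1 \<bar>f x - g x\<bar> \<le> min 1 \<bar>f' x - g' x\<bar> + min 1 \<bar>f'' x - g'' x\<bar>"
      by linarith
  qed (intro int set_integral_add; simp)+
  also have "\<dots> = meas_dist M K f' g' + meas_dist M K f'' g''"
    unfolding meas_dist_def by (intro set_integral_add int) auto
  finally show ?thesis .
qed

text \<open>Dominated convergence: truncation makes the indicator of \<open>K\<close> a majorant,
  and it is integrable because \<open>K\<close> has finite measure.\<close>

lemma meas_dist_tendsto_0:
  assumes K: "K \<in> sets M" "emeasure M K < \<infinity>"
    and [measurable]: "f \<in> borel_measurable M" "\<And>i. s i \<in> borel_measurable M"
    and lim: "\<And>x. x \<in> space M \<Longrightarrow> (\<lambda>i. s i x) \<longlonglongrightarrow> f x"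
  shows "(\<lambda>i. meas_dist M K f (s i)) \<longlonglongrightarrow> 0"
proof -
  note [measurable] = K(1)
  have "(\<lambda>i. LINT x|M. indicator K x *\<^sub>R min 1 \<bar>f x - s i x\<bar>) \<longlonglongrightarrow> (LINT x|M. 0)"
  proof (rule integral_dominated_convergence[where w = "indicator K"])
    show "AE x in M. (\<lambda>i. indicator K x *\<^sub>R min 1 \<bar>f x - s i x\<bar>) \<longlonglongrightarrow> 0"
    proof (rule AE_I2)
      fix x assume "x \<in> space M"
      then have "(\<lambda>i. indicator K x *\<^sub>R min 1 \<bar>f x - s i x\<bar>) \<longlonglongrightarrow> indicator K x *\<^sub>R min 1 \<bar>f x - f x\<bar>"
        by (intro tendsto_intros lim)
      then show "(\<lambda>i. indicator K x *\<^sub>R min 1 \<bar>f x - s i x\<bar>) \<longlonglongrightarrow> 0" by simp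
    qed
    show "integrable M (indicat_real K)" using K by (intro integrable_real_indicator)
    show "AE x in M. norm (indicator K x *\<^sub>R min 1 \<bar>f x - s i x\<bar>) \<le> indicat_real K x" for i
      by (auto simp: indicator_def)
  qed auto
  then show ?thesis by (simp add: meas_dist_def set_lebesgue_integral_def)
qed

text \<open>At a point of \<open>K\<close> that lies in both or neither of \<open>E\<close> and
  \<open>E\<^sub>0\<close> the values differ by at most \<open>\<bar>c - r\<bar>\<close>; at the
  other points the truncation bounds the integrand by 1, whatever the size of \<open>c\<close> and
  \<open>r\<close>. Writing \<open>E \<inter> K\<close> prepares for sets \<open>E\<close> of
  infinite measure.\<close>

lemma meas_dist_indicators_le:
  assumes K: "K \<in> sets M" "emeasure M K < \<infinity>" and [measurable]: "E \<in> sets M" "E\<^sub>0 \<in> sets M"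
  shows "meas_dist M K (\<lambda>x. c * indicator E x) (\<lambda>x. r * indicator E\<^sub>0 x) \<le>
    \<bar>c - r\<bar> * measure M K + measure M (K \<inter> sym_diff (E \<inter> K) E\<^sub>0)"
proof -
  note [measurable] = K(1)
  have "meas_dist M K (\<lambda>x. c * indicator E x) (\<lambda>x. r * indicator E\<^sub>0 x) \<le>
      (LINT x:K|M. \<bar>c - r\<bar> + indicator (sym_diff (E \<inter> K) E\<^sub>0) x)"
    unfolding meas_dist_def
    by (rule set_integral_mono)
      (auto simp: indicator_def intro!: set_integrable_bounded[where C = 1]
        set_integrable_bounded[where C = "\<bar>c - r\<bar> + 1"] K)
  also have "\<dots> = (LINT x:K|M. \<bar>c - r\<bar>) + (LINT x:K|M. indicator (sym_diff (E \<inter> K) E\<^sub>0) x)"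
    by (intro set_integral_add)
      (auto simp: indicator_def intro!: set_integrable_bounded[where C = 1]
        set_integrable_bounded[where C = "\<bar>c - r\<bar> + 1"] K)
  also have "(LINT x:K|M. \<bar>c - r\<bar>) = \<bar>c - r\<bar> * measure M K"
    using K by (simp add: set_lebesgue_integral_def)
  also have "(LINT x:K|M. indicator (sym_diff (E \<inter> K) E\<^sub>0) x) =
      measure M (K \<inter> sym_diff (E \<inter> K) E\<^sub>0)"
  proof -
    have "(LINT x:K|M. indicat_real (sym_diff (E \<inter> K) E\<^sub>0) x) =
        (LINT x|M. indicat_real (K \<inter> sym_diff (E \<inter> K) E\<^sub>0) x)"
      unfolding set_lebesgue_integral_def by (simp add: indicator_inter_arith)
    then show ?thesis by simp
  qed
  finally show ?thesis .
qed

section \<open>A countable dense set of functions with supports of finite measure\<close>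

definition dense_in_measure :: "'a measure \<Rightarrow> ('a \<Rightarrow> real) set \<Rightarrow> bool" where
  "dense_in_measure M Q \<longleftrightarrow> (\<forall>f\<in>borel_measurable M. \<forall>K\<in>sets M. emeasure M K < \<infinity> \<longrightarrow>
    (\<forall>\<epsilon>>0. \<exists>q\<in>Q. meas_dist M K f q < \<epsilon>))"

text \<open>\<open>Q\<close> consists of the rational combinations of indicators of sets of finite
  measure in the countable family. These approximate multiples of indicators, hence simple functions
  term by term, hence all measurable functions as pointwise limits of simple ones.\<close>

lemma countable_dense_finite_support:
  fixes M :: "'a measure"
  assumes "countable \<A>" "\<A> \<subseteq> sets M"
    and approx: "\<And>E \<epsilon>. E \<in> sets M \<Longrightarrow> emeasure M E < \<infinity> \<Longrightarrow> \<epsilon> > 0 \<Longrightarrow>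
      \<exists>E\<^sub>0\<in>\<A>. emeasure M (sym_diff E E\<^sub>0) < ennreal \<epsilon>"
  obtains Q :: "('a \<Rightarrow> real) set" where "countable Q" "Q \<noteq> {}" "Q \<subseteq> borel_measurable M"
    "\<forall>q\<in>Q. emeasure M {x \<in> space M. q x \<noteq> 0} < \<infinity>" "dense_in_measure M Q"
proof -
  define \<B> where "\<B> = {E \<in> \<A>. emeasure M E < \<infinity>}"
  \<comment> \<open>Lists make countability immediate and turn addition into concatenation.\<close>
  define comb :: "(rat \<times> 'a set) list \<Rightarrow> 'a \<Rightarrow> real" where
    "comb l x = (\<Sum>(r, E)\<leftarrow>l. of_rat r * indicator E x)" for l x
  define Q where "Q = comb ` lists (UNIV \<times> \<B>)"
  have comb_simps: "comb [] = (\<lambda>x. 0)" "comb ((r, E) # l) = (\<lambda>x. of_rat r * indicator E x + comb l x)"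
    "comb (l @ l') = (\<lambda>x. comb l x + comb l' x)" for r E l l'
    by (auto simp: comb_def fun_eq_iff)
  have comb_props: "comb l \<in> borel_measurable M \<and> emeasure M {x \<in> space M. comb l x \<noteq> 0} < \<infinity>"
    if "l \<in> lists (UNIV \<times> \<B>)" for l
    using that
  proof induction
    case Nil
    then show ?case by (simp add: comb_simps)
  next
    case (Cons p l)
    obtain r E where p: "p = (r, E)" by fastforce
    with Cons have E [measurable]: "E \<in> sets M" and fin: "emeasure M E < \<infinity>"
      using assms(2) by (auto simp: \<B>_def)
    have [measurable]: "comb l \<in> borel_measurable M" using Cons by simp
    have "emeasure M {x \<in> space M. comb (p # l) x \<noteq> 0} \<le>
        emeasure M (E \<union> {x \<in> space M. comb l x \<noteq> 0})"
      by (intro emeasure_mono) (auto simp: p comb_simps indicator_def split: if_splits)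
    also have "\<dots> \<le> emeasure M E + emeasure M {x \<in> space M. comb l x \<noteq> 0}"
      by (intro emeasure_subadditive) auto
    also have "\<dots> < \<infinity>" using fin Cons by simp
    finally show ?case by (simp add: p comb_simps)
  qed
  have Q_meas: "q \<in> borel_measurable M" if "q \<in> Q" for q
    using that comb_props by (auto simp: Q_def)
  have Q_zero: "(\<lambda>x. 0) \<in> Q"
    unfolding Q_def by (rule image_eqI[of _ _ "[]"]) (auto simp: comb_simps)
  have Q_add: "(\<lambda>x. q x + q' x) \<in> Q" if "q \<in> Q" "q' \<in> Q" for q q'
  proof -
    from that obtain l l' where "l \<in> lists (UNIV \<times> \<B>)" "l' \<in> lists (UNIV \<times> \<B>)" "q = comb l" "q' = comb l'"
      by (auto simp: Q_def)
    then show ?thesis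
      unfolding Q_def by (intro image_eqI[of _ _ "l @ l'"]) (auto simp: comb_simps)
  qed
  show thesis
  proof (rule that[of Q])
    show "countable Q"
      unfolding Q_def \<B>_def using assms(1) by (intro countable_image countable_lists) auto
    show "Q \<noteq> {}" using Q_zero by auto
    show "Q \<subseteq> borel_measurable M" using Q_meas by auto
    show "\<forall>q\<in>Q. emeasure M {x \<in> space M. q x \<noteq> 0} < \<infinity>"
      using comb_props by (auto simp: Q_def)
    show "dense_in_measure M Q"
      unfolding dense_in_measure_def
    proof (intro ballI allI impI)
      fix f :: "'a \<Rightarrow> real" and K and \<epsilon> :: real
      assume f [measurable]: "f \<in> borel_measurable M" and K: "K \<in> sets M" "emeasure M K < \<infinity>" and "\<epsilon> > 0"
      have ind: "\<exists>q\<in>Q. meas_dist M K (\<lambda>x. c * indicator E x) q < \<epsilon>"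
        if [measurable]: "E \<in> sets M" and "\<epsilon> > 0" for c E and \<epsilon> :: real
      proof -
        \<comment> \<open>The summand 1 keeps the denominator positive when \<open>K\<close> is a
          null set.\<close>
        define \<delta> where "\<delta> = \<epsilon> / (2 * (measure M K + 1))"
        have "\<delta> > 0" using \<open>\<epsilon> > 0\<close> by (simp add: \<delta>_def add_nonneg_pos)
        then obtain r where r: "r \<in> \<rat>" "\<bar>c - r\<bar> < \<delta>"
          using Rats_dense_in_real[of "c - \<delta>" c] by force
        then obtain r' where r': "r = of_rat r'" by (auto elim: Rats_cases)
        \<comment> \<open>\<open>E\<close> may have infinite measure, but the distance only sees its
          trace on \<open>K\<close>, to which \<open>approx\<close> applies.\<close>
        have "emeasure M (E \<inter> K) < \<infinity>"
          using K by (meson emeasure_mono inf_le2 le_less_trans)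
        then obtain E\<^sub>0 where E\<^sub>0: "E\<^sub>0 \<in> \<A>" "emeasure M (sym_diff (E \<inter> K) E\<^sub>0) < ennreal (\<epsilon> / 2)"
          using approx[of "E \<inter> K" "\<epsilon> / 2"] K \<open>\<epsilon> > 0\<close> by auto
        have E\<^sub>0s [measurable]: "E\<^sub>0 \<in> sets M" using E\<^sub>0 assms by auto
        note [measurable] = K(1)
        \<comment> \<open>The approximating set inherits finite measure from
          \<open>E \<inter> K\<close>, and therefore belongs to \<open>\<B>\<close>.\<close>
        have "emeasure M E\<^sub>0 \<le> emeasure M ((E \<inter> K) \<union> sym_diff (E \<inter> K) E\<^sub>0)"
          by (intro emeasure_mono) auto
        also have "\<dots> \<le> emeasure M (E \<inter> K) + emeasure M (sym_diff (E \<inter> K) E\<^sub>0)"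
          by (intro emeasure_subadditive) auto
        also have "\<dots> < \<infinity>"
          using \<open>emeasure M (E \<inter> K) < \<infinity>\<close> E\<^sub>0(2) by (auto simp: less_top[symmetric])
        finally have "E\<^sub>0 \<in> \<B>" using E\<^sub>0 by (simp add: \<B>_def)
        then have "(\<lambda>x. r * indicator E\<^sub>0 x) \<in> Q"
          unfolding Q_def by (intro image_eqI[of _ _ "[(r', E\<^sub>0)]"]) (auto simp: comb_simps r')
        moreover have "meas_dist M K (\<lambda>x. c * indicator E x) (\<lambda>x. r * indicator E\<^sub>0 x) < \<epsilon>"
        proof -
          have "emeasure M (K \<inter> sym_diff (E \<inter> K) E\<^sub>0) < ennreal (\<epsilon> / 2)"
            by (rule le_less_trans[OF emeasure_mono E\<^sub>0(2)]) auto
          moreover from this have "emeasure M (K \<inter> sym_diff (E \<inter> K) E\<^sub>0) \<noteq> \<infinity>" by auto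
          ultimately have "measure M (K \<inter> sym_diff (E \<inter> K) E\<^sub>0) < \<epsilon> / 2"
            by (metis emeasure_eq_ennreal_measure ennreal_less_iff infinity_ennreal_def measure_nonneg)
          moreover have "\<bar>c - r\<bar> * measure M K \<le> \<delta> * (measure M K + 1)"
            using r by (intro mult_mono) auto
          moreover have "\<delta> * (measure M K + 1) = \<epsilon> / 2"
          proof -
            have "measure M K + 1 \<noteq> 0" using measure_nonneg[of M K] by linarith
            then show ?thesis unfolding \<delta>_def
              by (metis divide_divide_eq_left nonzero_eq_divide_eq)
          qed
          ultimately show ?thesis
            using meas_dist_indicators_le[OF K that(1) E\<^sub>0s, of c r] by linarith
        qed
        ultimately show ?thesis by blast
      qed
      have sums: "\<exists>q\<in>Q. meas_dist M K (\<lambda>x. \<Sum>y\<in>Y. y * indicator (E y) x) q < \<epsilon>"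
        if "finite Y" "\<And>y. y \<in> Y \<Longrightarrow> E y \<in> sets M" "\<epsilon> > 0" for Y E and \<epsilon> :: real
        using that
      proof (induction arbitrary: \<epsilon>)
        case empty
        then show ?case using Q_zero by (intro bexI[of _ "\<lambda>x. 0"]) (auto simp: meas_dist_def)
      next
        case (insert y Y)
        obtain q where q: "q \<in> Q" "meas_dist M K (\<lambda>x. y * indicator (E y) x) q < \<epsilon> / 2"
          using ind[of "E y" "\<epsilon> / 2" y] insert by auto
        obtain q' where q': "q' \<in> Q" "meas_dist M K (\<lambda>x. \<Sum>y\<in>Y. y * indicator (E y) x) q' < \<epsilon> / 2"
          using insert.IH[of "\<epsilon> / 2"] insert by auto
        have meas: "(\<lambda>x. y * indicator (E y) x) \<in> borel_measurable M" "(\<lambda>x. \<Sum>y\<in>Y. y * indicator (E y) x) \<in> borel_measurable M"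
          using insert.prems(1)
          by (auto intro!: borel_measurable_sum borel_measurable_times borel_measurable_indicator
              simp del: sum_mult_indicator)
        have "meas_dist M K (\<lambda>x. \<Sum>y\<in>insert y Y. y * indicator (E y) x) (\<lambda>x. q x + q' x) \<le>
            meas_dist M K (\<lambda>x. y * indicator (E y) x) q +
            meas_dist M K (\<lambda>x. \<Sum>y\<in>Y. y * indicator (E y) x) q'"
          unfolding sum.insert[OF insert(1,2)] using Q_meas[OF q(1)] Q_meas[OF q'(1)] meas
        proof (intro meas_dist_le_add K)
          fix x
          show "\<bar>y * indicator (E y) x + (\<Sum>y\<in>Y. y * indicator (E y) x) - (q x + q' x)\<bar> \<le>
              \<bar>y * indicator (E y) x - q x\<bar> + \<bar>(\<Sum>y\<in>Y. y * indicator (E y) x) - q' x\<bar>"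
            by linarith
        qed (simp_all only: meas borel_measurable_add)
        with q q' Q_add[OF q(1) q'(1)] show ?case by force
      qed
      obtain s where s: "\<And>i. simple_function M (s i)" "\<And>x. x \<in> space M \<Longrightarrow> (\<lambda>i. s i x) \<longlonglongrightarrow> f x"
        using borel_measurable_implies_sequence_metric[OF f, of 0] by blast
      have [measurable]: "s i \<in> borel_measurable M" for i
        using s(1) by (rule borel_measurable_simple_function)
      have "\<forall>\<^sub>F i in sequentially. meas_dist M K f (s i) < \<epsilon> / 2"
        using meas_dist_tendsto_0[OF K f _ s(2)] \<open>\<epsilon> > 0\<close> by (intro order_tendstoD(2)[where y = 0]) auto
      then obtain i where i: "meas_dist M K f (s i) < \<epsilon> / 2"
        by (auto simp: eventually_sequentially)
      \<comment> \<open>The canonical representation of \<open>s i\<close> by its finitely many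
        values. It agrees with \<open>s i\<close> on \<open>space M\<close>, which is all that
        \<open>meas_dist_le_add\<close> asks for.\<close>
      define g where "g x = (\<Sum>y\<in>s i ` space M. y * indicator (s i -` {y} \<inter> space M) x)" for x
      have g: "s i x = g x" if "x \<in> space M" for x
        using simple_function_indicator_representation_banach[OF s(1) that, of i]
        by (simp only: g_def real_scaleR_def mult.commute)
      obtain q where q: "q \<in> Q" "meas_dist M K g q < \<epsilon> / 2"
      proof -
        have "\<exists>q\<in>Q. meas_dist M K g q < \<epsilon> / 2"
          unfolding g_def[abs_def]
          by (rule sums) (use simple_functionD[OF s(1)] \<open>\<epsilon> > 0\<close> in auto)
        then show thesis using that by blast
      qed
      have [measurable]: "g \<in> borel_measurable M"
        using measurable_cong[of M "s i" g borel] g by simp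
      have "meas_dist M K f q \<le> meas_dist M K f (s i) + meas_dist M K g q"
        using Q_meas[OF q(1)] by (intro meas_dist_le_add K) (auto simp: g)
      with i q show "\<exists>q\<in>Q. meas_dist M K f q < \<epsilon>" by force
    qed
  qed
qed

section \<open>Density in the space of classes and in the product\<close>

text \<open>An open set around the class of \<open>f\<close> contains a translate of some
  \<open>L0_nhd M K \<epsilon>\<close>, and the class of \<open>q\<close> is the translate of the
  class of \<open>q - f\<close>, which lies in that neighborhood when
  \<open>meas_dist M K f q < \<epsilon>\<close>.\<close>

lemma L0_dense:
  assumes "Q \<subseteq> borel_measurable M" and "dense_in_measure M Q"
  shows "L0_topology M closure_of (ae_class M ` Q) = topspace (L0_topology M)"
proof (intro antisym closure_of_subset_topspace subsetI)
  fix F assume F: "F \<in> topspace (L0_topology M)"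
  then obtain f where f: "f \<in> borel_measurable M" "F = ae_class M f"
    by (auto simp: topspace_L0_topology carrier_L0)
  have "\<exists>G. G \<in> ae_class M ` Q \<and> G \<in> U" if "F \<in> U" "openin (L0_topology M) U" for U
  proof -
    from that obtain K \<epsilon> where K: "K \<in> sets M" "emeasure M K < \<infinity>" "\<epsilon> > 0"
        "(\<lambda>G. F \<oplus>\<^bsub>L0 M\<^esub> G) ` L0_nhd M K \<epsilon> \<subseteq> U"
      unfolding openin_L0_topology L0_open_def by meson
    obtain q where q: "q \<in> Q" "meas_dist M K f q < \<epsilon>"
      using assms(2) f(1) K(1-3) unfolding dense_in_measure_def by blast
    with assms(1) have qm: "q \<in> borel_measurable M" by auto
    have "ae_class M (\<lambda>x. q x - f x) \<in> L0_nhd M K \<epsilon>"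
      using q qm f unfolding L0_nhd_def
      by (intro imageI) (auto simp: meas_dist_def abs_minus_commute)
    then have "F \<oplus>\<^bsub>L0 M\<^esub> ae_class M (\<lambda>x. q x - f x) \<in> U" using K(4) by blast
    moreover have "F \<oplus>\<^bsub>L0 M\<^esub> ae_class M (\<lambda>x. q x - f x) = ae_class M q"
      using f qm by (simp add: L0_add)
    ultimately show ?thesis using q by auto
  qed
  with F show "F \<in> L0_topology M closure_of (ae_class M ` Q)"
    by (auto simp: in_closure_of)
qed

text \<open>A basic open set restricts only finitely many coordinates, all below some
  \<open>m\<close>; density of \<open>D\<close> fills these, and the later ones are free. Density in
  the product thus reduces to realizing every finite list over \<open>D\<close> as a prefix.\<close>

lemma product_topology_dense_finite_prefix:
  fixes T :: "nat \<Rightarrow> 'b topology"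
  assumes dense: "\<And>n. T n closure_of D = topspace (T n)"
    and U: "openin (product_topology T UNIV) U" "s \<in> U"
  obtains l where "l \<in> lists D"
    "\<And>t. t \<in> topspace (product_topology T UNIV) \<Longrightarrow> (\<And>n. n < length l \<Longrightarrow> t n = l ! n) \<Longrightarrow> t \<in> U"
proof -
  obtain X where X: "s \<in> (\<Pi>\<^sub>E n\<in>UNIV. X n)" "\<And>n. openin (T n) (X n)"
      "finite {n. X n \<noteq> topspace (T n)}" "(\<Pi>\<^sub>E n\<in>UNIV. X n) \<subseteq> U"
    using product_topology_open_contains_basis[OF U] by blast
  obtain m where m: "\<And>n. X n \<noteq> topspace (T n) \<Longrightarrow> n < m"
    using X(3) finite_nat_set_iff_bounded by auto
  have "\<exists>d\<in>D. d \<in> X n" for n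
  proof -
    have "s n \<in> X n" using X(1) by auto
    then have "s n \<in> T n closure_of D"
      using X(2)[of n] openin_subset dense by blast
    with \<open>s n \<in> X n\<close> X(2)[of n] show ?thesis
      by (auto simp: in_closure_of)
  qed
  then obtain d where d: "\<And>n. d n \<in> D" "\<And>n. d n \<in> X n" by metis
  show thesis
  proof (rule that[of "map d [0..<m]"])
    fix t assume t: "t \<in> topspace (product_topology T UNIV)"
      "\<And>n. n < length (map d [0..<m]) \<Longrightarrow> t n = map d [0..<m] ! n"
    have "t n \<in> X n" for n
    proof (cases "n < m")
      case True
      then show ?thesis using t(2)[of n] d by simp
    next
      case False
      then have "X n = topspace (T n)" using m by blast
      then show ?thesis using t(1) by auto
    qed
    with X(4) show "t \<in> U" by (auto simp: PiE_UNIV_domain)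
  qed (use d in auto)
qed

section \<open>Growth of exponential sums\<close>

text \<open>Let \<open>m\<close> be the largest element of \<open>F\<close>. Multiplying by
  \<open>exp (- (real n * exp m))\<close> leaves the limit \<open>a m \<noteq> 0\<close>. The inner
  \<open>exp\<close> makes all rates positive, so this factor is at most 1 and would preserve
  convergence to 0.\<close>

lemma exp_combination_not_tendsto_0:
  fixes a :: "real \<Rightarrow> real"
  assumes "finite F" "F \<noteq> {}" "\<And>t. t \<in> F \<Longrightarrow> a t \<noteq> 0"
  shows "\<not> (\<lambda>n. \<Sum>t\<in>F. a t * exp (real n * exp t)) \<longlonglongrightarrow> 0"
proof
  assume lim: "(\<lambda>n. \<Sum>t\<in>F. a t * exp (real n * exp t)) \<longlonglongrightarrow> 0"
  define m where "m = Max F"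
  have m: "m \<in> F" using assms by (simp add: m_def)
  have "(\<lambda>n. (\<Sum>t\<in>F. a t * exp (real n * exp t)) * exp (- (real n * exp m))) \<longlonglongrightarrow> 0"
  proof (rule Lim_null_comparison[OF _ lim[THEN tendsto_norm_zero]])
    show "\<forall>\<^sub>F n in sequentially. norm ((\<Sum>t\<in>F. a t * exp (real n * exp t)) * exp (- (real n * exp m)))
        \<le> norm (\<Sum>t\<in>F. a t * exp (real n * exp t))"
      by (intro always_eventually allI) (simp add: abs_mult mult_left_le)
  qed
  moreover have "(\<lambda>n. (\<Sum>t\<in>F. a t * exp (real n * exp t)) * exp (- (real n * exp m))) \<longlonglongrightarrow>
      (\<Sum>t\<in>F. if t = m then a m else 0)"
    unfolding sum_distrib_right
  proof (rule tendsto_sum)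
    fix t assume "t \<in> F"
    then have "t \<le> m" using assms by (simp add: m_def)
    show "(\<lambda>n. a t * exp (real n * exp t) * exp (- (real n * exp m))) \<longlonglongrightarrow> (if t = m then a m else 0)"
    proof (cases "t = m")
      case True
      then show ?thesis by (simp add: mult.assoc flip: exp_add)
    next
      case False
      with \<open>t \<le> m\<close> have *: "exp (exp t - exp m) < 1" by simp
      \<comment> \<open>The damped term is a geometric sequence, with ratio below 1 because
        \<open>t < m\<close>.\<close>
      have "(\<lambda>n. a t * exp (exp t - exp m) ^ n) \<longlonglongrightarrow> a t * 0"
        by (intro tendsto_mult tendsto_const LIMSEQ_realpow_zero) (use * in auto)
      moreover have "a t * exp (real n * exp t) * exp (- (real n * exp m)) = a t * exp (exp t - exp m) ^ n" for n
        by (simp add: mult.assoc flip: exp_of_nat_mult exp_add) (simp add: algebra_simps)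
      ultimately show ?thesis using False by (simp only: mult_zero_right if_False)
    qed
  qed
  ultimately have "(\<Sum>t\<in>F. if t = m then a m else 0) = 0"
    by (rule LIMSEQ_unique[rotated])
  then show False
    using m assms by simp
qed

section \<open>Convergence of sequences that eventually live on small sets\<close>

abbreviation seq_class :: "'a measure \<Rightarrow> (nat \<Rightarrow> 'a \<Rightarrow> real) \<Rightarrow> nat \<Rightarrow> ('a \<Rightarrow> real) set" where
  "seq_class M f \<equiv> (\<lambda>n. ae_class M (f n))"

lemma zero_L0_seq: "\<zero>\<^bsub>L0_seq M\<^esub> = seq_class M (\<lambda>n x. 0)"
  by (simp add: L0_seq_def L0_zero)

lemma zero_in_S_u: "\<zero>\<^bsub>L0_seq M\<^esub> \<in> S_u M"
  unfolding zero_L0_seq by (subst S_u_iff) (auto intro!: bexI[of _ "{}"] uniform_limitI)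

text \<open>From \<open>N\<close> on the level sets lie in \<open>A n\<close>, so the series is at
  most a finite sum of finite measures plus a geometric series.\<close>

lemma S_cI:
  assumes f [measurable]: "\<And>n. f n \<in> borel_measurable M"
    and A: "\<And>n. A n \<in> sets M" "\<And>n. emeasure M (A n) \<le> ennreal ((1/2) ^ n)"
    and fin: "\<And>n. emeasure M {x \<in> space M. f n x \<noteq> 0} < \<infinity>"
    and off: "\<And>n x. n \<ge> N \<Longrightarrow> x \<in> space M - A n \<Longrightarrow> f n x = 0"
  shows "seq_class M f \<in> S_c M"
proof (subst S_c_iff[OF f], intro allI impI)
  fix \<epsilon> :: real assume "\<epsilon> > 0"
  let ?e = "\<lambda>n. emeasure M {x \<in> space M. f n x \<noteq> 0}"
  have "(\<Sum>n. emeasure M {x \<in> space M. \<bar>f n x\<bar> > \<epsilon>}) \<le> (\<Sum>n. (if n \<in> {..<N} then ?e n else 0) + ennreal ((1/2) ^ n))"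
  proof (rule suminf_le)
    fix n
    show "emeasure M {x \<in> space M. \<bar>f n x\<bar> > \<epsilon>} \<le> (if n \<in> {..<N} then ?e n else 0) + ennreal ((1/2) ^ n)"
    proof (cases "n < N")
      case True
      have "emeasure M {x \<in> space M. \<bar>f n x\<bar> > \<epsilon>} \<le> ?e n"
        using \<open>\<epsilon> > 0\<close> by (intro emeasure_mono) auto
      with True show ?thesis by (auto intro: add_increasing2)
    next
      case False
      have "emeasure M {x \<in> space M. \<bar>f n x\<bar> > \<epsilon>} \<le> emeasure M (A n)"
        using \<open>\<epsilon> > 0\<close> off[of n] False A by (intro emeasure_mono) force+
      with False A(2)[of n] show ?thesis by auto
    qed
  qed auto
  also have "\<dots> = (\<Sum>n. if n \<in> {..<N} then ?e n else 0) + (\<Sum>n. ennreal ((1/2) ^ n))"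
    by (rule suminf_add[symmetric]) auto
  also have "(\<Sum>n. if n \<in> {..<N} then ?e n else 0) = (\<Sum>n<N. ?e n)"
    by (subst suminf_finite[of "{..<N}"]) auto
  also have "(\<Sum>n. ennreal ((1/2) ^ n)) = ennreal (\<Sum>n. (1/2) ^ n)"
    by (rule suminf_ennreal2) (auto intro: summable_geometric)
  also have "(\<Sum>n<N. ?e n) + ennreal (\<Sum>n. (1/2) ^ n) < \<infinity>"
    using fin by (auto simp: sum_Pinfty less_top)
  finally show "(\<Sum>n. emeasure M {x \<in> space M. \<bar>f n x\<bar> > \<epsilon>}) < \<infinity>" .
qed

text \<open>The exceptional set is a tail union of the sets \<open>A n\<close>: its measure is at
  most a geometric tail, and outside it the later functions vanish identically.\<close>

lemma S_auI:
  assumes f: "\<And>n. f n \<in> borel_measurable M"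
    and A: "\<And>n. A n \<in> sets M" "\<And>n. emeasure M (A n) \<le> ennreal ((1/2) ^ n)"
    and off: "\<And>n x. n \<ge> N \<Longrightarrow> x \<in> space M - A n \<Longrightarrow> f n x = 0"
  shows "seq_class M f \<in> S_au M"
proof (subst S_au_iff[OF f], intro allI impI)
  fix \<epsilon> :: real assume "\<epsilon> > 0"
  have "(\<lambda>k. 2 * (1/2) ^ k :: real) \<longlonglongrightarrow> 2 * 0"
    by (intro tendsto_mult tendsto_const LIMSEQ_realpow_zero) auto
  with \<open>\<epsilon> > 0\<close> have "\<forall>\<^sub>F k in sequentially. 2 * (1/2) ^ k < \<epsilon>"
    by (intro order_tendstoD(2)[where y = 0]) auto
  \<comment> \<open>Taking \<open>k \<ge> N\<close> makes \<open>off\<close> available for every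
    index from \<open>k\<close> on.\<close>
  then obtain k where k: "k \<ge> N" "2 * (1/2) ^ k < \<epsilon>"
    unfolding eventually_sequentially by (meson nle_le)
  let ?Z = "\<Union>n. A (n + k)"
  have "emeasure M ?Z \<le> (\<Sum>n. emeasure M (A (n + k)))"
    using A(1) by (intro emeasure_subadditive_countably) auto
  also have "\<dots> \<le> (\<Sum>n. ennreal ((1/2) ^ (n + k)))"
    by (intro suminf_le A) auto
  also have "\<dots> = ennreal (2 * (1/2) ^ k)"
  proof (rule suminf_ennreal_eq)
    show "(\<lambda>n. (1/2) ^ (n + k)) sums (2 * (1/2) ^ k :: real)"
      using sums_mult2[OF geometric_sums[of "1/2::real"], of "(1/2) ^ k"] by (simp add: power_add)
  qed auto
  also have "\<dots> < ennreal \<epsilon>" using k by (simp add: ennreal_less_iff)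
  finally have "emeasure M ?Z < ennreal \<epsilon>" .
  moreover have "uniform_limit (space M - ?Z) f (\<lambda>x. 0) sequentially"
  proof (rule uniform_limitI)
    fix e :: real assume "e > 0"
    have "dist (f n x) 0 < e" if "n \<ge> k" "x \<in> space M - ?Z" for n x
    proof -
      have "x \<in> space M - A n"
        using that by (auto dest: spec[of _ "n - k"])
      then show ?thesis using off[of n x] that k \<open>e > 0\<close> by simp
    qed
    then show "\<forall>\<^sub>F n in sequentially. \<forall>x\<in>space M - ?Z. dist (f n x) 0 < e"
      unfolding eventually_sequentially by blast
  qed
  ultimately show "\<exists>Z\<in>sets M. emeasure M Z < ennreal \<epsilon> \<and> uniform_limit (space M - Z) f (\<lambda>x. 0) sequentially"
    using A(1) by (intro bexI[of _ ?Z]) auto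
qed

text \<open>Each \<open>A n\<close> has positive measure and so contains a point outside the
  exceptional null set. Uniform convergence, evaluated at points that vary with \<open>n\<close>,
  forces the constants to 0.\<close>

lemma S_u_amplitude_tendsto_0:
  assumes f: "\<And>n. f n \<in> borel_measurable M" and "seq_class M f \<in> S_u M"
    and A: "\<And>n. A n \<in> sets M" "\<And>n. emeasure M (A n) > 0"
    and on: "\<And>n x. n \<ge> N \<Longrightarrow> x \<in> A n \<Longrightarrow> f n x = c n"
  shows "c \<longlonglongrightarrow> 0"
proof -
  obtain Z where Z: "Z \<in> null_sets M" "uniform_limit (space M - Z) f (\<lambda>x. 0) sequentially"
    using assms(2) by (subst (asm) S_u_iff[OF f]) auto
  have "\<exists>x. x \<in> A n - Z" for n
  proof (rule ccontr)
    assume "\<nexists>x. x \<in> A n - Z"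
    then have "A n \<subseteq> Z" by auto
    with A(1) Z(1) have "A n \<in> null_sets M" by (metis null_sets_subset)
    with A(2)[of n] show False by auto
  qed
  then obtain x where x: "\<And>n. x n \<in> A n - Z" by metis
  have xs: "x n \<in> space M - Z" for n using x[of n] A(1)[of n] sets.sets_into_space by blast
  show ?thesis
  proof (rule tendstoI)
    fix e :: real assume "e > 0"
    from uniform_limitD[OF Z(2) this] eventually_ge_at_top[of N]
    show "\<forall>\<^sub>F n in sequentially. dist (c n) 0 < e"
    proof eventually_elim
      case (elim n)
      then show ?case using bspec[OF elim(1) xs[of n]] on[of n "x n"] x[of n] by simp
    qed
  qed
qed

section \<open>Linear combinations and the span of a family indexed by the reals\<close>

lemma seq_class_in_carrier:
  assumes "\<And>n. f n \<in> borel_measurable M"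
  shows "seq_class M f \<in> carrier (L0_seq M)"
  using assms by (simp add: L0_seq_def carrier_L0)

text \<open>The coefficients of \<open>lincomb\<close> are attached to vectors, not to indices.
  Injectivity ensures that each new index contributes a new vector in the induction.\<close>

lemma lincomb_seq_class:
  assumes W: "\<And>t n. W t n \<in> borel_measurable M"
    and "finite F" and "inj_on (\<lambda>t. seq_class M (W t)) F"
  shows "module.lincomb (L0_seq M) a ((\<lambda>t. seq_class M (W t)) ` F) =
    seq_class M (\<lambda>n x. \<Sum>t\<in>F. a (seq_class M (W t)) * W t n x)"
proof -
  interpret vectorspace class_ring "L0_seq M" by (rule vectorspace_L0_seq)
  let ?w = "\<lambda>t. seq_class M (W t)"
  have w: "?w t \<in> carrier (L0_seq M)" for t by (rule seq_class_in_carrier[OF W])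
  show ?thesis using assms(2,3)
  proof (induction F)
    case empty
    then show ?case by (simp add: lincomb_def zero_L0_seq)
  next
    case (insert t F)
    have "lincomb a (?w ` insert t F) = lincomb a (?w ` F \<union> {?w t})" by simp
    also have "\<dots> = a (?w t) \<odot>\<^bsub>L0_seq M\<^esub> ?w t \<oplus>\<^bsub>L0_seq M\<^esub> lincomb a (?w ` F)"
      using insert w by (intro lincomb_insert) auto
    also have "\<dots> = seq_class M (\<lambda>n x. \<Sum>t\<in>insert t F. a (?w t) * W t n x)"
      using insert W by (simp add: L0_seq_def L0_smult L0_add)
    finally show ?case .
  qed
qed

text \<open>Everything algebraic follows from \<open>comb\<close> and \<open>zero\<close>: a
  coincidence between two members, or a linear dependence, would put the zero vector into
  \<open>S\<close>. So the family is a basis of its span with as many elements as there are reals,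
  and the span is dense because the family already is.\<close>

lemma continuum_dense_lineable_span:
  fixes W :: "real \<Rightarrow> nat \<Rightarrow> 'a \<Rightarrow> real"
  assumes W: "\<And>t n. W t n \<in> borel_measurable M"
    and comb: "\<And>F a. finite F \<Longrightarrow> F \<noteq> {} \<Longrightarrow> (\<And>t. t \<in> F \<Longrightarrow> a t \<noteq> 0) \<Longrightarrow>
      seq_class M (\<lambda>n x. \<Sum>t\<in>F. a t * W t n x) \<in> S"
    and zero: "\<zero>\<^bsub>L0_seq M\<^esub> \<notin> S"
    and dense: "L0_seq_topology M closure_of range (\<lambda>t. seq_class M (W t)) = topspace (L0_seq_topology M)"
  shows "continuum_dense_lineable (L0_seq M) (L0_seq_topology M) S"
proof -
  interpret vectorspace class_ring "L0_seq M" by (rule vectorspace_L0_seq)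
  let ?w = "\<lambda>t. seq_class M (W t)"
  let ?B = "range ?w"
  have w: "?w t \<in> carrier (L0_seq M)" for t by (rule seq_class_in_carrier[OF W])
  then have B: "?B \<subseteq> carrier (L0_seq M)" by auto
  have inj: "inj ?w"
  proof (rule injI, rule ccontr)
    fix s t assume eq: "?w s = ?w t" and "s \<noteq> t"
    \<comment> \<open>With coefficients 1 and -1 the combination is the difference of two sequences
      with equal classes.\<close>
    define a :: "real \<Rightarrow> real" where "a r = (if r = s then 1 else - 1)" for r
    have "seq_class M (\<lambda>n x. \<Sum>r\<in>{s, t}. a r * W r n x) = \<zero>\<^bsub>L0_seq M\<^esub>"
      unfolding zero_L0_seq
    proof
      fix n
      have "AE x in M. W s n x = W t n x"
        using fun_cong[OF eq, of n] W by (simp add: ae_class_eq_iff)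
      then show "ae_class M (\<lambda>x. \<Sum>r\<in>{s, t}. a r * W r n x) = ae_class M (\<lambda>x. 0)"
        using W \<open>s \<noteq> t\<close> by (subst ae_class_eq_iff) (auto simp: a_def)
    qed
    moreover have "seq_class M (\<lambda>n x. \<Sum>r\<in>{s, t}. a r * W r n x) \<in> S"
      by (rule comb) (auto simp: a_def)
    ultimately show False using zero by simp
  qed
  \<comment> \<open>This dichotomy yields both linear independence and the inclusion of the nonzero
    part of the span in \<open>S\<close>.\<close>
  have lincomb_cases: "lincomb a C \<in> S \<or> (\<forall>v\<in>C. a v = 0) \<and> lincomb a C = \<zero>\<^bsub>L0_seq M\<^esub>"
    if "finite C" "C \<subseteq> ?B" for a C
  proof -
    from that obtain F where F: "finite F" "C = ?w ` F"
      by (meson finite_subset_image)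
    have eq: "lincomb a C = seq_class M (\<lambda>n x. \<Sum>t\<in>F. a (?w t) * W t n x)"
      unfolding F(2) by (rule lincomb_seq_class[OF W F(1)]) (use inj in \<open>auto intro: inj_on_subset\<close>)
    \<comment> \<open>Zero coefficients are discarded, since \<open>comb\<close> requires all
      coefficients to be nonzero.\<close>
    define G where "G = {t \<in> F. a (?w t) \<noteq> 0}"
    have G: "(\<Sum>t\<in>F. a (?w t) * W t n x) = (\<Sum>t\<in>G. a (?w t) * W t n x)" for n x
      unfolding G_def by (rule sum.mono_neutral_right) (use F in auto)
    show ?thesis
    proof (cases "G = {}")
      case True
      then show ?thesis unfolding eq G by (auto simp: F G_def zero_L0_seq)
    next
      case False
      then show ?thesis unfolding eq G using F by (intro disjI1 comb) (auto simp: G_def)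
    qed
  qed
  have indpt: "lin_indpt ?B"
    unfolding lin_dep_def using lincomb_cases zero by (auto simp: class_ring_simps) metis
  have sub: "submodule class_ring (span ?B) (L0_seq M)" by (rule span_is_submodule[OF B])
  have Bs: "?B \<subseteq> span ?B" by (rule in_own_span[OF B])
  interpret V: vectorspace class_ring "vs (span ?B)"
    by (rule subspace_is_vs[OF span_is_subspace[OF B]])
  \<comment> \<open>Span and independence do not change on passing from the whole space to the
    subspace.\<close>
  have "V.basis ?B"
    unfolding V.basis_def using span_li_not_depend[OF Bs sub] indpt Bs by simp
  moreover have "subspace class_ring (span ?B) (L0_seq M)" by (rule span_is_subspace[OF B])
  moreover have "L0_seq_topology M closure_of span ?B = topspace (L0_seq_topology M)"
    using closure_of_mono[OF Bs, of "L0_seq_topology M"] closure_of_subset_topspace[of "L0_seq_topology M" "span ?B"]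
    unfolding dense by blast
  moreover have "?B \<approx> (UNIV :: real set)"
    using inj by (rule inj_on_image_eqpoll_self)
  moreover have "span ?B - {\<zero>\<^bsub>L0_seq M\<^esub>} \<subseteq> S"
    using lincomb_cases unfolding span_def by blast
  ultimately show ?thesis
    unfolding continuum_dense_lineable_def by blast
qed

lemma continuum_dense_lineable_mono:
  assumes "continuum_dense_lineable X T A" "A \<subseteq> B"
  shows "continuum_dense_lineable X T B"
  using assms unfolding continuum_dense_lineable_def by (meson subset_trans)

section \<open>Construction of the family and conclusion\<close>

theorem theorem3p9:
  fixes M :: "'a measure"
  assumes "sigma_finite_measure M"
    and "\<exists>\<A>\<^sub>1. countable \<A>\<^sub>1 \<and> \<A>\<^sub>1 \<subseteq> sets M \<and>
      (\<forall>E\<in>sets M. emeasure M E < \<infinity> \<longrightarrow>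
        (\<forall>\<epsilon>>0. \<exists>E\<^sub>0\<in>\<A>\<^sub>1. emeasure M (sym_diff E E\<^sub>0) < ennreal \<epsilon>))"
    and "\<exists>A :: nat \<Rightarrow> 'a set. range A \<subseteq> sets M \<and> disjoint_family A \<and>
      (\<forall>n. emeasure M (A n) > 0) \<and> (\<lambda>n. emeasure M (A n)) \<longlonglongrightarrow> 0"
  shows "continuum_dense_lineable (L0_seq M) (L0_seq_topology M) ((S_c M \<inter> S_au M) - S_u M) \<and>
    continuum_dense_lineable (L0_seq M) (L0_seq_topology M) (S_c M - S_u M) \<and>
    continuum_dense_lineable (L0_seq M) (L0_seq_topology M) (S_au M - S_u M)"
proof -
  obtain A :: "nat \<Rightarrow> 'a set" where A: "\<And>n. A n \<in> sets M" "\<And>n. emeasure M (A n) > 0"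
    "\<And>n. emeasure M (A n) \<le> ennreal ((1/2) ^ n)"
  proof -
    obtain A' :: "nat \<Rightarrow> 'a set" where A': "\<And>n. A' n \<in> sets M" "\<And>n. emeasure M (A' n) > 0"
      "(\<lambda>n. emeasure M (A' n)) \<longlonglongrightarrow> 0"
      using assms(3) by (auto simp: image_subset_iff)
    have "\<exists>k. emeasure M (A' k) < ennreal ((1/2) ^ n)" for n
    proof -
      have "\<forall>\<^sub>F k in sequentially. emeasure M (A' k) < ennreal ((1/2) ^ n)"
        by (rule order_tendstoD(2)[OF A'(3)]) simp
      then show ?thesis by (auto simp: eventually_sequentially)
    qed
    then obtain r where "\<And>n. emeasure M (A' (r n)) < ennreal ((1/2) ^ n)" by metis
    with A' show thesis by (intro that[of "\<lambda>n. A' (r n)"]) (auto intro: less_imp_le)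
  qed
  note [measurable] = A(1)
  obtain \<A> where \<A>: "countable \<A>" "\<A> \<subseteq> sets M"
    "\<And>E \<epsilon>. E \<in> sets M \<Longrightarrow> emeasure M E < \<infinity> \<Longrightarrow> \<epsilon> > 0 \<Longrightarrow>
      \<exists>E\<^sub>0\<in>\<A>. emeasure M (sym_diff E E\<^sub>0) < ennreal \<epsilon>"
    using assms(2) by metis
  obtain Q :: "('a \<Rightarrow> real) set" where Q: "countable Q" "Q \<noteq> {}" "Q \<subseteq> borel_measurable M"
    "\<forall>q\<in>Q. emeasure M {x \<in> space M. q x \<noteq> 0} < \<infinity>" "dense_in_measure M Q"
    by (rule countable_dense_finite_support[OF \<A>])
  \<comment> \<open>The naturals enumerate all finite lists over \<open>Q\<close>; every other real
    gets the empty list, which leaves its sequence unmodified.\<close>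
  define L :: "real \<Rightarrow> ('a \<Rightarrow> real) list" where
    "L t = (if t \<in> \<nat> then from_nat_into (lists Q) (nat \<lfloor>t\<rfloor>) else [])" for t
  define W :: "real \<Rightarrow> nat \<Rightarrow> 'a \<Rightarrow> real" where
    "W t n = (if n < length (L t) then L t ! n else (\<lambda>x. exp (real n * exp t) * indicator (A n) x))" for t n
  \<comment> \<open>Nonemptiness guarantees that \<open>from_nat_into\<close> takes its values in
    \<open>lists Q\<close>.\<close>
  have "lists Q \<noteq> {}" using lists.Nil by blast
  then have L: "set (L t) \<subseteq> Q" for t
    using from_nat_into[of "lists Q"] by (auto simp: L_def)
  have L_surj: "\<exists>t. L t = l" if "l \<in> lists Q" for l
  proof -
    obtain j where "from_nat_into (lists Q) j = l"
      using from_nat_into_surj[OF countable_lists[OF Q(1)] \<open>l \<in> lists Q\<close>] by blast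
    then have "L (real j) = l" by (simp add: L_def)
    then show ?thesis ..
  qed
  have W_prefix: "W t n \<in> Q" if "n < length (L t)" for t n
    using that L[of t] nth_mem[OF that] by (auto simp: W_def)
  have W_meas [measurable]: "W t n \<in> borel_measurable M" for t n
  proof (cases "n < length (L t)")
    case True
    then show ?thesis using W_prefix Q(3) by blast
  qed (simp add: W_def)
  have W_fin: "emeasure M {x \<in> space M. W t n x \<noteq> 0} < \<infinity>" for t n
  proof (cases "n < length (L t)")
    case True
    then show ?thesis using W_prefix Q(4) by blast
  next
    case False
    then have "emeasure M {x \<in> space M. W t n x \<noteq> 0} \<le> emeasure M (A n)"
      by (intro emeasure_mono) (auto simp: W_def indicator_def)
    also have "\<dots> < \<infinity>" using A(3)[of n] by (auto simp: less_top[symmetric] top_unique)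
    finally show ?thesis .
  qed
  have comb: "seq_class M (\<lambda>n x. \<Sum>t\<in>F. a t * W t n x) \<in> S_c M \<inter> S_au M - S_u M"
    if F: "finite F" "F \<noteq> {}" "\<And>t. t \<in> F \<Longrightarrow> a t \<noteq> 0" for F and a :: "real \<Rightarrow> real"
  proof -
    define f where "f n x = (\<Sum>t\<in>F. a t * W t n x)" for n x
    have f_meas: "f n \<in> borel_measurable M" for n
      unfolding f_def by measurable
    \<comment> \<open>Beyond \<open>N\<close> no member of the combination is affected by its
      replaced prefix, so \<open>f n\<close> is a constant multiple of the indicator of
      \<open>A n\<close>.\<close>
    obtain N where N: "\<And>t. t \<in> F \<Longrightarrow> length (L t) \<le> N"
      using finite_nat_set_iff_bounded_le[of "(\<lambda>t. length (L t)) ` F"] F(1) by auto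
    have tail: "f n x = (\<Sum>t\<in>F. a t * exp (real n * exp t)) * indicator (A n) x" if "n \<ge> N" for n x
      unfolding f_def sum_distrib_right
      by (rule sum.cong) (use N that in \<open>force simp: W_def\<close>)+
    \<comment> \<open>This controls the first \<open>N\<close> terms of the series for complete
      convergence.\<close>
    have "emeasure M {x \<in> space M. f n x \<noteq> 0} < \<infinity>" for n
    proof -
      have "emeasure M {x \<in> space M. f n x \<noteq> 0} \<le> emeasure M (\<Union>t\<in>F. {x \<in> space M. W t n x \<noteq> 0})"
        using F(1) by (intro emeasure_mono) (auto simp: f_def elim!: sum.not_neutral_contains_not_neutral)
      also have "\<dots> \<le> (\<Sum>t\<in>F. emeasure M {x \<in> space M. W t n x \<noteq> 0})"
        using F(1) by (intro emeasure_subadditive_finite) auto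
      also have "\<dots> < \<infinity>" using W_fin F(1) by (simp add: sum_Pinfty less_top)
      finally show ?thesis .
    qed
    then have "seq_class M f \<in> S_c M"
      by (rule S_cI[where A = A and N = N, OF f_meas A(1,3)]) (use tail in auto)
    moreover have "seq_class M f \<in> S_au M"
      by (rule S_auI[where A = A and N = N, OF f_meas A(1,3)]) (use tail in auto)
    moreover have "seq_class M f \<notin> S_u M"
    proof
      assume "seq_class M f \<in> S_u M"
      then have "(\<lambda>n. \<Sum>t\<in>F. a t * exp (real n * exp t)) \<longlonglongrightarrow> 0"
        by (rule S_u_amplitude_tendsto_0[where A = A and N = N, OF f_meas _ A(1,2)]) (use tail in auto)
      with exp_combination_not_tendsto_0[OF F] show False by simp
    qed
    ultimately show ?thesis by (simp add: f_def[abs_def])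
  qed
  have dense: "L0_seq_topology M closure_of range (\<lambda>t. seq_class M (W t)) = topspace (L0_seq_topology M)"
  proof (intro antisym closure_of_subset_topspace subsetI)
    fix s assume s: "s \<in> topspace (L0_seq_topology M)"
    have "\<exists>t. seq_class M (W t) \<in> U" if "s \<in> U" "openin (L0_seq_topology M) U" for U
    proof (rule product_topology_dense_finite_prefix[OF L0_dense[OF Q(3,5)] _ that(1)])
      show "openin (product_topology (\<lambda>_. L0_topology M) UNIV) U"
        using that(2) by (simp only: L0_seq_topology_def)
      fix l assume "l \<in> lists (ae_class M ` Q)"
        and prefix: "\<And>t. t \<in> topspace (product_topology (\<lambda>_. L0_topology M) UNIV) \<Longrightarrow>
          (\<And>n. n < length l \<Longrightarrow> t n = l ! n) \<Longrightarrow> t \<in> U"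
      \<comment> \<open>The list of classes is lifted to a list of functions, and a \<open>t\<close>
        with this list as its prefix gives a member of the family in \<open>U\<close>.\<close>
      then obtain l' where l': "l' \<in> lists Q" "l = map (ae_class M) l'"
        by (auto simp: lists_image)
      obtain t where t: "L t = l'" using L_surj[OF l'(1)] by blast
      have "seq_class M (W t) \<in> topspace (L0_seq_topology M)"
        unfolding topspace_L0_seq_topology by (rule seq_class_in_carrier[OF W_meas])
      then have "seq_class M (W t) \<in> U"
        unfolding L0_seq_topology_def by (rule prefix) (simp add: l' t W_def)
      then show ?thesis ..
    qed
    with s show "s \<in> L0_seq_topology M closure_of range (\<lambda>t. seq_class M (W t))"
      by (auto simp: in_closure_of)
  qed
  \<comment> \<open>The zero sequence is excluded because it lies in \<open>S_u M\<close>.\<close>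
  have "continuum_dense_lineable (L0_seq M) (L0_seq_topology M) (S_c M \<inter> S_au M - S_u M)"
    by (rule continuum_dense_lineable_span[OF W_meas comb _ dense]) (simp_all add: zero_in_S_u)
  then show ?thesis
    by (blast intro: continuum_dense_lineable_mono)
qed

end
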